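(* Let $S$ be a separable concrete operator system (on some Hilbert space), let $A = C^*(S)$ be the unital C*-algebra it generates, and let $\pi : A \to B(H)$ be a representation of $A$ acting on a separable Hilbert space $H$. The following are equivalent: (1) $\pi|_S$ has the unique extension property; (2) for every sequence $\{\phi_n\}$ in $\mathrm{UCP}(A, B(H))$ such that $\{\phi_n|_S\}$ converges to $\pi|_S$ in the BW-topology on $\mathrm{UCP}(S, B(H))$, the sequence $\{\phi_n\}$ converges to $\pi$ in the BW-topology on $\mathrm{UCP}(A, B(H))$; (3) for every sequence $\{\phi_n\}$ in $\mathrm{UCP}(A, B(H))$ such that $\{\phi_n|_S\}$ converges to $\pi|_S$ in the BW-topology on $\mathrm{UCP}(S, B(H))$, there exists a subsequence $\{\phi_{n_k}\}$ that converges to $\pi$ in the BW-topology on $\mathrm{UCP}(A, B(H))$. Moreover, the same equivalence holds if BW-convergence is replaced by BS-convergence throughout (2) and (3).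
   Context: A concrete operator system is a unital self-adjoint linear subspace of $B(L)$ for some Hilbert space $L$. $\mathrm{UCP}(S_1, S_2)$ denotes the set of unital completely positive (ucp) maps $S_1 \to S_2$. A representation of $A$ is a $*$-homomorphism $\pi : A \to B(H)$, assumed nondegenerate (the closed span of $\pi(A)H$ is $H$). For an operator system $S$ generating $A = C^*(S)$ and a representation $\pi : A \to B(H)$, $\pi|_S$ has the unique extension property (equivalently, $\pi$ has the UEP relative to $S$) if the only ucp map $\phi : A \to B(H)$ with $\phi|_S = \pi|_S$ is $\phi = \pi$. For $E = S$ or $E = A$: a sequence $\{\phi_n\}$ in $\mathrm{UCP}(E, B(H))$ converges to $\psi$ in the BW (bounded weak) topology if $\langle (\phi_n(e) - \psi(e))\xi, \eta\rangle \to 0$ for all $e \in E$ and $\xi, \eta \in H$; it BS-converges (bounded strong) to $\psi$ if $\|(\phi_n(e) - \psi(e))\xi\| \to 0$ for all $e \in E$ and $\xi \in H$. *)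

theory Defs
  imports "HOL-Analysis.Analysis"
begin

class scaleC =
  fixes scaleC :: "complex \<Rightarrow> 'a \<Rightarrow> 'a"  (infixr \<open>*\<^sub>C\<close> 75)

class complex_vector = ab_group_add + scaleC +
  assumes scaleC_add_right: "c *\<^sub>C (x + y) = c *\<^sub>C x + c *\<^sub>C y"
    and scaleC_add_left: "(c + d) *\<^sub>C x = c *\<^sub>C x + d *\<^sub>C x"
    and scaleC_scaleC: "c *\<^sub>C (d *\<^sub>C x) = (c * d) *\<^sub>C x"
    and scaleC_one: "1 *\<^sub>C x = x"

global_interpretation cvec: vector_space "scaleC :: complex \<Rightarrow> 'a \<Rightarrow> 'a::complex_vector"
  defines csubspace = cvec.subspace
    and cspan = cvec.span
  by unfold_locales (simp_all add: scaleC_add_right scaleC_add_left scaleC_scaleC scaleC_one)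

text \<open>The inner product is linear in the first argument. Positive definiteness is
  contained in \<open>cinner_self\<close>, since the norm is a norm.\<close>

class complex_hilbert = banach + complex_vector +
  fixes cinner :: "'a \<Rightarrow> 'a \<Rightarrow> complex"
  assumes scaleR_scaleC: "r *\<^sub>R x = complex_of_real r *\<^sub>C x"
    and cinner_commute: "cinner x y = cnj (cinner y x)"
    and cinner_add_left: "cinner (x + y) z = cinner x z + cinner y z"
    and cinner_scaleC_left: "cinner (c *\<^sub>C x) y = c * cinner x y"
    and cinner_self: "cinner x x = complex_of_real ((norm x)\<^sup>2)"

instantiation complex :: complex_hilbert
begin
definition scaleC_complex :: "complex \<Rightarrow> complex \<Rightarrow> complex" where
  "scaleC_complex c x = c * x"
definition cinner_complex :: "complex \<Rightarrow> complex \<Rightarrow> complex" where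
  "cinner_complex x y = x * cnj y"
instance
  by standard
    (simp_all add: scaleC_complex_def cinner_complex_def algebra_simps scaleR_conv_of_real
      complex_norm_square del: of_real_power)
end

lemma cinner_add_right: "cinner x (y + z) = cinner x y + cinner x (z::'a::complex_hilbert)"
  by (metis cinner_add_left cinner_commute complex_cnj_add)

lemma cinner_scaleC_right: "cinner x (c *\<^sub>C y) = cnj c * cinner x (y::'a::complex_hilbert)"
  by (metis cinner_scaleC_left cinner_commute complex_cnj_mult)

lemma cinner_diff_left: "cinner (x - y) z = cinner x z - cinner y (z::'a::complex_hilbert)"
  by (metis cinner_add_left diff_add_cancel add_diff_cancel_right')

lemma cinner_diff_right: "cinner x (y - z) = cinner x y - cinner x (z::'a::complex_hilbert)"
  by (metis cinner_add_right diff_add_cancel add_diff_cancel_right')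

lemma cinner_scaleR_left: "cinner (r *\<^sub>R x) y = of_real r * cinner x (y::'a::complex_hilbert)"
  by (simp add: scaleR_scaleC cinner_scaleC_left)

lemma cinner_scaleR_right: "cinner x (r *\<^sub>R y) = of_real r * cinner x (y::'a::complex_hilbert)"
  by (simp add: scaleR_scaleC cinner_scaleC_right)

lemma norm_sq_cinner: "(norm (x::'a::complex_hilbert))\<^sup>2 = Re (cinner x x)"
  by (simp add: cinner_self del: of_real_power)

lemma norm_scaleC: "norm (c *\<^sub>C (x::'a::complex_hilbert)) = cmod c * norm x"
proof -
  have "complex_of_real ((norm (c *\<^sub>C x))\<^sup>2) = c * cnj c * cinner x x"
    by (simp add: cinner_self[symmetric] cinner_scaleC_left cinner_scaleC_right mult.assoc
        del: of_real_power)
  also have "\<dots> = complex_of_real ((cmod c * norm x)\<^sup>2)"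
    by (simp only: cinner_self complex_norm_square[symmetric] of_real_mult[symmetric]
        power_mult_distrib)
  finally have "(norm (c *\<^sub>C x))\<^sup>2 = (cmod c * norm x)\<^sup>2"
    by (simp only: of_real_eq_iff)
  then show ?thesis
    by (simp add: power2_eq_iff_nonneg)
qed

lemma scaleR_scaleC_commute:
  "r *\<^sub>R (c *\<^sub>C x) = c *\<^sub>C (r *\<^sub>R (x::'a::complex_hilbert))"
  by (simp add: scaleR_scaleC scaleC_scaleC mult.commute)

lemma bounded_linear_scaleC: "bounded_linear (\<lambda>x::'a::complex_hilbert. c *\<^sub>C x)"
  by (rule bounded_linear_intro[where K = "cmod c"])
    (simp_all add: scaleC_add_right scaleR_scaleC_commute norm_scaleC mult.commute)

lemma norm_add_sq:
  "(norm (x + y))\<^sup>2 = (norm x)\<^sup>2 + (norm y)\<^sup>2 + 2 * Re (cinner x (y::'a::complex_hilbert))"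
proof -
  have "Re (cinner y x) = Re (cinner x y)"
    by (subst cinner_commute) simp
  then show ?thesis
    by (simp add: norm_sq_cinner cinner_add_left cinner_add_right)
qed

lemma Cauchy_Schwarz_Re: "Re (cinner x (y::'a::complex_hilbert)) \<le> norm x * norm y"
proof -
  have "(norm (x + y))\<^sup>2 \<le> (norm x + norm y)\<^sup>2"
    by (simp add: norm_triangle_ineq power_mono)
  then show ?thesis
    by (simp add: norm_add_sq power2_sum)
qed

lemma cinner_eq_zero_imp: "(\<And>x. cinner x (y::'a::complex_hilbert) = 0) \<Longrightarrow> y = 0"
  using cinner_self[of y] by simp

lemma Riesz_complex_hilbert:
  fixes f :: "'a::complex_hilbert \<Rightarrow> complex"
  assumes f: "bounded_linear f" and fC: "\<And>c x. f (c *\<^sub>C x) = c * f x"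
  shows "\<exists>z. \<forall>x. f x = cinner x z"
proof -
  interpret f: bounded_linear f by (fact f)
  define J where "J x = (norm x)\<^sup>2 - 2 * Re (f x)" for x
  obtain K where K: "\<And>x. norm (f x) \<le> norm x * K" "K > 0"
    using f.pos_bounded by blast
  have low: "J x \<ge> - K\<^sup>2" for x
  proof -
    have "Re (f x) \<le> norm x * K"
      using complex_Re_le_cmod[of "f x"] K(1)[of x] by linarith
    moreover have "0 \<le> (norm x - K)\<^sup>2" by simp
    ultimately show ?thesis by (simp add: J_def power2_diff)
  qed
  define m where "m = Inf (range J)"
  have bdd: "bdd_below (range J)"
    using low by (meson bdd_belowI2)
  have m: "m \<le> J x" for x
    unfolding m_def using bdd by (simp add: cInf_lower)
  have "\<exists>x. J x < m + inverse (real (Suc n))" for n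
  proof -
    have "\<exists>y\<in>range J. y < m + inverse (real (Suc n))"
      unfolding m_def by (rule cInf_lessD) (simp_all)
    then show ?thesis by blast
  qed
  then obtain X where X: "\<And>n. J (X n) < m + inverse (real (Suc n))"
    by metis
  have para: "(norm (x - y))\<^sup>2 = 2 * J x + 2 * J y - 4 * J ((1/2) *\<^sub>R (x + y))" for x y
  proof -
    have a: "(norm (x - y))\<^sup>2 = (norm x)\<^sup>2 + (norm y)\<^sup>2 - 2 * Re (cinner x y)"
      using norm_add_sq[of x "- y"] cinner_diff_right[of x 0 y] cinner_diff_right[of x 0 0]
      by simp
    have b: "4 * J ((1/2) *\<^sub>R (x + y)) = (norm (x + y))\<^sup>2 - 4 * Re (f x) - 4 * Re (f y)"
      by (simp add: J_def f.scaleR f.add power_divide add_divide_distrib)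
    show ?thesis unfolding a b norm_add_sq by (simp add: J_def)
  qed
  have "Cauchy X"
  proof (rule metric_CauchyI)
    fix e :: real assume e: "e > 0"
    obtain N where N: "inverse (real (Suc N)) < e\<^sup>2 / 4"
      using reals_Archimedean[of "e\<^sup>2 / 4"] e by auto
    have "dist (X p) (X q) < e" if "p \<ge> N" "q \<ge> N" for p q
    proof -
      have "inverse (real (Suc p)) \<le> inverse (real (Suc N))"
           "inverse (real (Suc q)) \<le> inverse (real (Suc N))"
        using that by (simp_all add: le_imp_inverse_le)
      then have "(norm (X p - X q))\<^sup>2 < e\<^sup>2"
        unfolding para using X[of p] X[of q] m[of "(1/2) *\<^sub>R (X p + X q)"] N by linarith
      then show ?thesis
        using e by (simp add: dist_norm power2_less_imp_less)
    qed
    then show "\<exists>M. \<forall>p\<ge>M. \<forall>q\<ge>M. dist (X p) (X q) < e" by blast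
  qed
  then obtain z where z: "X \<longlonglongrightarrow> z"
    using Cauchy_convergent convergent_def by blast
  have "(\<lambda>n. J (X n)) \<longlonglongrightarrow> J z"
    unfolding J_def by (intro tendsto_intros f.tendsto z)
  moreover have "(\<lambda>n. m + inverse (real (Suc n))) \<longlonglongrightarrow> m + 0"
    by (intro tendsto_intros LIMSEQ_inverse_real_of_nat)
  ultimately have "J z \<le> m + 0"
    using X by (meson LIMSEQ_le less_imp_le)
  then have min: "J z \<le> J x" for x using m[of x] by linarith
  have Re_eq: "Re (f h) = Re (cinner h z)" for h
  proof -
    define d where "d = Re (cinner h z) - Re (f h)"
    have ineq: "0 \<le> t\<^sup>2 * (norm h)\<^sup>2 + 2 * t * d" for t :: real
    proof -
      have "J (t *\<^sub>R h + z) = J z + t\<^sup>2 * (norm h)\<^sup>2 + 2 * t * d"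
        unfolding J_def norm_add_sq d_def
        by (simp add: f.add f.scaleR cinner_scaleR_left power_mult_distrib algebra_simps)
      then show ?thesis using min[of "t *\<^sub>R h + z"] by linarith
    qed
    have "d = 0"
    proof (cases "h = 0")
      case True
      then show ?thesis using ineq[of 1] ineq[of "-1"] by simp
    next
      case False
      define q where "q = (norm h)\<^sup>2"
      have q: "q > 0" using False by (simp add: q_def)
      have "0 \<le> (- d / q)\<^sup>2 * q + 2 * (- d / q) * d"
        using ineq[of "- d / q"] by (simp add: q_def)
      also have "\<dots> = - (d\<^sup>2 / q)"
        using q by (simp add: field_simps power2_eq_square)
      finally have "d\<^sup>2 / q \<le> 0" by simp
      then show ?thesis using q by (simp add: divide_le_0_iff)
    qed
    then show ?thesis by (simp add: d_def)
  qed
  have "f x = cinner x z" for x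
  proof (rule complex_eqI)
    show "Re (f x) = Re (cinner x z)" by (rule Re_eq)
    show "Im (f x) = Im (cinner x z)"
      using Re_eq[of "\<i> *\<^sub>C x"] by (simp add: fC cinner_scaleC_left)
  qed
  then show ?thesis by blast
qed

text \<open>Elements of the library type of bounded linear maps are only real linear, so
  \<open>B(H)\<close> is the set of the complex linear ones among them. The operator
  norm and its topology are the library ones.\<close>

instantiation blinfun :: (real_normed_vector, complex_hilbert) complex_vector
begin
lift_definition scaleC_blinfun :: "complex \<Rightarrow> 'a \<Rightarrow>\<^sub>L 'b \<Rightarrow> 'a \<Rightarrow>\<^sub>L 'b"
  is "\<lambda>c T x. c *\<^sub>C T x"
  by (rule bounded_linear_compose[OF bounded_linear_scaleC])
instance
  by standard
    (transfer; simp add: fun_eq_iff scaleC_add_right scaleC_add_left scaleC_scaleC scaleC_one)+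
end

definition bounded_operators :: "('h::complex_hilbert \<Rightarrow>\<^sub>L 'h) set" where
  "bounded_operators = {T. \<forall>c x. blinfun_apply T (c *\<^sub>C x) = c *\<^sub>C blinfun_apply T x}"

definition is_adjoint ::
    "('h::complex_hilbert \<Rightarrow>\<^sub>L 'h) \<Rightarrow> ('h \<Rightarrow>\<^sub>L 'h) \<Rightarrow> bool" where
  "is_adjoint T T' \<longleftrightarrow>
     (\<forall>x y. cinner (blinfun_apply T x) y = cinner x (blinfun_apply T' y))"

definition adj :: "('h::complex_hilbert \<Rightarrow>\<^sub>L 'h) \<Rightarrow> ('h \<Rightarrow>\<^sub>L 'h)" where
  "adj T = (THE T'. is_adjoint T T')"

lemma is_adjoint_unique: "is_adjoint T T1 \<Longrightarrow> is_adjoint T T2 \<Longrightarrow> T1 = T2"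
proof (rule blinfun_eqI)
  fix y assume "is_adjoint T T1" "is_adjoint T T2"
  then have "cinner x (T1 y - T2 y) = 0" for x
    by (simp add: is_adjoint_def cinner_diff_right)
  then show "T1 y = T2 y"
    using cinner_eq_zero_imp by fastforce
qed

lemma is_adjoint_exists:
  assumes "T \<in> bounded_operators"
  shows "\<exists>T'. is_adjoint T T'"
proof -
  have T: "T (c *\<^sub>C x) = c *\<^sub>C T x" for c x
    using assms by (simp add: bounded_operators_def)
  have CS: "cmod (cinner x y) \<le> norm x * norm y" for x y :: 'a
  proof (cases "cinner x y = 0")
    case False
    define u where "u = cnj (cinner x y) / cmod (cinner x y)"
    have u: "cmod u = 1" using False by (simp add: u_def norm_divide)
    have "cinner (u *\<^sub>C x) y = cmod (cinner x y)"
      using False complex_norm_square[of "cinner x y"]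
      by (simp add: cinner_scaleC_left u_def field_simps power2_eq_square)
    then show ?thesis
      using Cauchy_Schwarz_Re[of "u *\<^sub>C x" y] by (simp add: norm_scaleC u)
  qed simp
  have "\<exists>z. \<forall>x. cinner (T x) y = cinner x z" for y
  proof (rule Riesz_complex_hilbert)
    show "bounded_linear (\<lambda>x. cinner (T x) y)"
    proof (rule bounded_linear_intro[where K = "norm T * norm y"])
      fix x
      have "cmod (cinner (T x) y) \<le> norm (T x) * norm y" by (rule CS)
      also have "\<dots> \<le> (norm T * norm x) * norm y"
        by (intro mult_right_mono norm_blinfun) simp
      finally show "cmod (cinner (T x) y) \<le> norm x * (norm T * norm y)"
        by (simp add: mult_ac)
    qed (simp_all add: blinfun.add_right blinfun.scaleR_right cinner_add_left
        cinner_scaleR_left scaleR_conv_of_real)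
  qed (simp add: T cinner_scaleC_left)
  then obtain g where g: "\<And>x y. cinner (T x) y = cinner x (g y)" by metis
  have eqI: "a = b" if "\<And>x. cinner x a = cinner x b" for a b :: 'a
    using cinner_eq_zero_imp[of "a - b"] that by (simp add: cinner_diff_right)
  have "bounded_linear g"
  proof (rule bounded_linear_intro[where K = "norm T"])
    show "g (x + y) = g x + g y" for x y
      by (rule eqI) (simp add: cinner_add_right g[symmetric])
    show "g (r *\<^sub>R x) = r *\<^sub>R g x" for r x
      by (rule eqI) (simp add: cinner_scaleR_right g[symmetric])
    show "norm (g y) \<le> norm y * norm T" for y
    proof -
      have "norm (g y) * norm (g y) = Re (cinner (T (g y)) y)"
        by (simp add: g norm_sq_cinner[symmetric] power2_eq_square)
      also have "\<dots> \<le> norm (T (g y)) * norm y" by (rule Cauchy_Schwarz_Re)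
      also have "\<dots> \<le> (norm T * norm (g y)) * norm y"
        by (intro mult_right_mono norm_blinfun) simp
      finally have "norm (g y) * norm (g y) \<le> norm (g y) * (norm y * norm T)"
        by (simp add: mult_ac)
      then show ?thesis
        by (cases "g y = 0") (simp_all add: mult_le_cancel_left)
    qed
  qed
  then have "is_adjoint T (Blinfun g)"
    by (simp add: is_adjoint_def bounded_linear_Blinfun_apply g)
  then show ?thesis by blast
qed

lemma adj_is_adjoint: "T \<in> bounded_operators \<Longrightarrow> is_adjoint T (adj T)"
  unfolding adj_def by (metis is_adjoint_exists is_adjoint_unique theI)

definition operator_system :: "('l::complex_hilbert \<Rightarrow>\<^sub>L 'l) set \<Rightarrow> bool" where
  "operator_system S \<longleftrightarrow>
     S \<subseteq> bounded_operators \<and> csubspace S \<and> id_blinfun \<in> S \<and> (\<forall>s\<in>S. adj s \<in> S)"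

definition unital_Cstar_algebra :: "('l::complex_hilbert \<Rightarrow>\<^sub>L 'l) set \<Rightarrow> bool" where
  "unital_Cstar_algebra A \<longleftrightarrow>
     A \<subseteq> bounded_operators \<and> csubspace A \<and> id_blinfun \<in> A \<and>
     (\<forall>a\<in>A. \<forall>b\<in>A. a o\<^sub>L b \<in> A) \<and> (\<forall>a\<in>A. adj a \<in> A) \<and> closed A"

definition Cstar :: "('l::complex_hilbert \<Rightarrow>\<^sub>L 'l) set \<Rightarrow> ('l \<Rightarrow>\<^sub>L 'l) set" where
  "Cstar S = \<Inter>{A. unital_Cstar_algebra A \<and> S \<subseteq> A}"

text \<open>An \<open>n \<times> n\<close> operator matrix, indexed by \<open>{..<n}\<close>, is positive as an
  operator on the \<open>n\<close>-fold direct sum of the Hilbert space.\<close>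

definition positive_matrix ::
    "nat \<Rightarrow> (nat \<Rightarrow> nat \<Rightarrow> ('h::complex_hilbert \<Rightarrow>\<^sub>L 'h)) \<Rightarrow> bool" where
  "positive_matrix n a \<longleftrightarrow>
     (\<forall>x :: nat \<Rightarrow> 'h.
        (\<Sum>i<n. \<Sum>j<n. cinner (blinfun_apply (a i j) (x j)) (x i)) \<in> \<real>\<^sub>\<ge>\<^sub>0)"

definition clinear_map_on ::
    "('a::complex_vector) set \<Rightarrow> ('a \<Rightarrow> 'b::complex_vector) \<Rightarrow> bool" where
  "clinear_map_on E f \<longleftrightarrow>
     (\<forall>x\<in>E. \<forall>y\<in>E. f (x + y) = f x + f y) \<and> (\<forall>c. \<forall>x\<in>E. f (c *\<^sub>C x) = c *\<^sub>C f x)"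

definition completely_positive ::
    "('l::complex_hilbert \<Rightarrow>\<^sub>L 'l) set \<Rightarrow>
     (('l \<Rightarrow>\<^sub>L 'l) \<Rightarrow> ('h::complex_hilbert \<Rightarrow>\<^sub>L 'h)) \<Rightarrow> bool" where
  "completely_positive E \<phi> \<longleftrightarrow>
     (\<forall>n a. (\<forall>i<n. \<forall>j<n. a i j \<in> E) \<and> positive_matrix n a
        \<longrightarrow> positive_matrix n (\<lambda>i j. \<phi> (a i j)))"

text \<open>Maps on \<open>E\<close> are total functions of which only the values on \<open>E\<close> matter;
  equality of two of them is always stated on \<open>E\<close>, and
  \<open>\<phi>\<close> itself also stands for its restriction to a subset of \<open>E\<close>.\<close>

definition UCP ::
    "('l::complex_hilbert \<Rightarrow>\<^sub>L 'l) set \<Rightarrow> ('h::complex_hilbert \<Rightarrow>\<^sub>L 'h) set \<Rightarrow>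
     (('l \<Rightarrow>\<^sub>L 'l) \<Rightarrow> ('h \<Rightarrow>\<^sub>L 'h)) set" where
  "UCP E F = {\<phi>. \<phi> \<in> E \<rightarrow> F \<and> clinear_map_on E \<phi> \<and> \<phi> id_blinfun = id_blinfun
                 \<and> completely_positive E \<phi>}"

definition star_representation ::
    "('l::complex_hilbert \<Rightarrow>\<^sub>L 'l) set \<Rightarrow>
     (('l \<Rightarrow>\<^sub>L 'l) \<Rightarrow> ('h::complex_hilbert \<Rightarrow>\<^sub>L 'h)) \<Rightarrow> bool" where
  "star_representation A \<pi> \<longleftrightarrow>
     \<pi> \<in> A \<rightarrow> bounded_operators \<and> clinear_map_on A \<pi> \<and>
     (\<forall>a\<in>A. \<forall>b\<in>A. \<pi> (a o\<^sub>L b) = \<pi> a o\<^sub>L \<pi> b) \<and>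
     (\<forall>a\<in>A. \<pi> (adj a) = adj (\<pi> a)) \<and>
     closure (cspan {blinfun_apply (\<pi> a) \<xi> | a \<xi>. a \<in> A}) = UNIV"

definition unique_extension_property ::
    "('l::complex_hilbert \<Rightarrow>\<^sub>L 'l) set \<Rightarrow>
     (('l \<Rightarrow>\<^sub>L 'l) \<Rightarrow> ('h::complex_hilbert \<Rightarrow>\<^sub>L 'h)) \<Rightarrow> bool" where
  "unique_extension_property S \<pi> \<longleftrightarrow>
     (\<forall>\<phi> \<in> UCP (Cstar S) bounded_operators.
        (\<forall>s\<in>S. \<phi> s = \<pi> s) \<longrightarrow> (\<forall>a\<in>Cstar S. \<phi> a = \<pi> a))"

definition BW_converges ::
    "('l::complex_hilbert \<Rightarrow>\<^sub>L 'l) set \<Rightarrow>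
     (nat \<Rightarrow> ('l \<Rightarrow>\<^sub>L 'l) \<Rightarrow> ('h::complex_hilbert \<Rightarrow>\<^sub>L 'h)) \<Rightarrow>
     (('l \<Rightarrow>\<^sub>L 'l) \<Rightarrow> ('h \<Rightarrow>\<^sub>L 'h)) \<Rightarrow> bool" where
  "BW_converges E \<phi> \<psi> \<longleftrightarrow>
     (\<forall>e\<in>E. \<forall>\<xi> \<eta>. (\<lambda>n. cinner (blinfun_apply (\<phi> n e - \<psi> e) \<xi>) \<eta>) \<longlonglongrightarrow> 0)"

definition BS_converges ::
    "('l::complex_hilbert \<Rightarrow>\<^sub>L 'l) set \<Rightarrow>
     (nat \<Rightarrow> ('l \<Rightarrow>\<^sub>L 'l) \<Rightarrow> ('h::complex_hilbert \<Rightarrow>\<^sub>L 'h)) \<Rightarrow>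
     (('l \<Rightarrow>\<^sub>L 'l) \<Rightarrow> ('h \<Rightarrow>\<^sub>L 'h)) \<Rightarrow> bool" where
  "BS_converges E \<phi> \<psi> \<longleftrightarrow>
     (\<forall>e\<in>E. \<forall>\<xi>. (\<lambda>n. norm (blinfun_apply (\<phi> n e - \<psi> e) \<xi>)) \<longlonglongrightarrow> 0)"

end

theory Submission
  imports Defs
begin

text \<open>
  The set of ucp maps is compact in the point-weak topology, so if \<open>\<phi>\<^sub>n \<rightarrow> \<pi>\<close> on \<open>S\<close> fails to
  extend to \<open>A\<close>, then some cluster point of a bad subsequence is a ucp map that agrees with \<open>\<pi>\<close>
  on \<open>S\<close> but not on \<open>A\<close>. Compactness is applied to filters rather than to subsequences, so no
  diagonal argument is involved. For the strong version, the
  Schwarz inequality \<open>\<phi>(a)\<^sup>* \<phi>(a) \<le> \<phi>(a\<^sup>* a)\<close> and multiplicativity of \<open>\<pi>\<close> turn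
  weak convergence on \<open>A\<close> into strong convergence on \<open>A\<close>. Conversely, a ucp map that
  agrees with \<open>\<pi>\<close> on \<open>S\<close> gives a constant sequence, whose limit on \<open>A\<close> is itself.
\<close>

section \<open>Inner products and adjoints\<close>

lemma cinner_eqI: "(\<And>x. cinner x a = cinner x b) \<Longrightarrow> a = (b::'a::complex_hilbert)"
  using cinner_eq_zero_imp[of "a - b"] by (simp add: cinner_diff_right)

lemma cinner_zero_left [simp]: "cinner 0 (y::'a::complex_hilbert) = 0"
  using cinner_scaleR_left[of 0 0 y] by simp

lemma cinner_zero_right [simp]: "cinner (x::'a::complex_hilbert) 0 = 0"
  using cinner_scaleR_right[of x 0 0] by simp

lemma cinner_minus_left: "cinner (- x) (y::'a::complex_hilbert) = - cinner x y"
  using cinner_diff_left[of 0 x y] by simp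

lemma cinner_minus_right: "cinner x (- y) = - cinner x (y::'a::complex_hilbert)"
  using cinner_diff_right[of x 0 y] by simp

text \<open>The unit scalar \<open>cnj z / cmod z\<close> rotates \<open>z\<close> onto the
  nonnegative real axis. Positivity arguments only control real parts; this turns such bounds into
  bounds on the modulus.\<close>

lemma cmod_le_of_Re_rotations_le:
  assumes "\<And>u. cmod u = 1 \<Longrightarrow> Re (u * z) \<le> C" "0 \<le> C"
  shows "cmod z \<le> C"
proof (cases "z = 0")
  case False
  have "Re (cnj z / cmod z * z) = cmod z"
    using False cmod_power2[of z] by (simp add: field_simps power2_eq_square)
  moreover have "cmod (cnj z / cmod z) = 1"
    using False by (simp add: norm_divide)
  ultimately show ?thesis
    using assms(1) by metis
qed (use assms in simp)

lemma Cauchy_Schwarz_cinner: "cmod (cinner x (y::'a::complex_hilbert)) \<le> norm x * norm y"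
proof (rule cmod_le_of_Re_rotations_le)
  fix u :: complex assume "cmod u = 1"
  then show "Re (u * cinner x y) \<le> norm x * norm y"
    using Cauchy_Schwarz_Re[of "u *\<^sub>C x" y] by (simp add: cinner_scaleC_left norm_scaleC)
qed simp

lemma bounded_operatorsD:
  "T \<in> bounded_operators \<Longrightarrow> blinfun_apply T (c *\<^sub>C x) = c *\<^sub>C blinfun_apply T x"
  by (simp add: bounded_operators_def)

lemma cinner_adj_right:
  "T \<in> bounded_operators \<Longrightarrow> cinner x (blinfun_apply (adj T) y) = cinner (blinfun_apply T x) y"
  using adj_is_adjoint[of T] by (simp add: is_adjoint_def)

lemma cinner_adj_left:
  "T \<in> bounded_operators \<Longrightarrow> cinner (blinfun_apply (adj T) x) y = cinner x (blinfun_apply T y)"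
  by (metis cinner_adj_right cinner_commute)

lemma adj_in_bounded_operators:
  assumes "T \<in> bounded_operators"
  shows "adj T \<in> bounded_operators"
proof -
  have "adj T (c *\<^sub>C x) = c *\<^sub>C adj T x" for c x
    by (rule cinner_eqI) (simp add: cinner_adj_right[OF assms] cinner_scaleC_right)
  then show ?thesis by (simp add: bounded_operators_def)
qed

section \<open>The generated C*-algebra\<close>

text \<open>Ensures that the family intersected in \<open>Cstar S\<close> is nonempty, as an empty
  intersection would be the whole type, real linear maps included. Closedness holds because norm
  limits are pointwise limits and scalar multiplication is continuous.\<close>

lemma unital_Cstar_algebra_bounded_operators:
  "unital_Cstar_algebra (bounded_operators :: ('l::complex_hilbert \<Rightarrow>\<^sub>L 'l) set)"
proof -
  have "closed (bounded_operators :: ('l \<Rightarrow>\<^sub>L 'l) set)"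
    unfolding closed_sequential_limits
  proof (intro allI impI, elim conjE)
    fix T and L :: "'l \<Rightarrow>\<^sub>L 'l"
    assume T: "\<forall>n. T n \<in> bounded_operators" and lim: "T \<longlonglongrightarrow> L"
    have L: "(\<lambda>n. T n x) \<longlonglongrightarrow> L x" for x
      by (rule blinfun.tendsto[OF lim tendsto_const])
    have "L (c *\<^sub>C x) = c *\<^sub>C L x" for c x
    proof (rule LIMSEQ_unique[OF L[of "c *\<^sub>C x"]])
      show "(\<lambda>n. T n (c *\<^sub>C x)) \<longlonglongrightarrow> c *\<^sub>C L x"
        using bounded_linear.tendsto[OF bounded_linear_scaleC L] T
        by (simp add: bounded_operatorsD)
    qed
    then show "L \<in> bounded_operators" by (simp add: bounded_operators_def)
  qed
  moreover have "csubspace (bounded_operators :: ('l \<Rightarrow>\<^sub>L 'l) set)"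
    unfolding cvec.subspace_def
    by (auto simp: bounded_operators_def blinfun.add_left scaleC_blinfun.rep_eq
        scaleC_add_right scaleC_scaleC mult.commute)
  ultimately show ?thesis
    by (simp add: unital_Cstar_algebra_def adj_in_bounded_operators)
       (simp add: bounded_operators_def)
qed

lemma unital_Cstar_algebra_Inter:
  assumes "\<A> \<noteq> {}" "\<And>A. A \<in> \<A> \<Longrightarrow> unital_Cstar_algebra A"
  shows "unital_Cstar_algebra (\<Inter>\<A>)"
  unfolding unital_Cstar_algebra_def
proof (intro conjI)
  show "csubspace (\<Inter>\<A>)"
    using assms(2) by (intro cvec.subspace_Inter) (simp add: unital_Cstar_algebra_def)
  show "closed (\<Inter>\<A>)"
    using assms(2) by (intro closed_Inter) (simp add: unital_Cstar_algebra_def)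
qed (use assms in \<open>unfold unital_Cstar_algebra_def, blast+\<close>)

lemma unital_Cstar_algebra_Cstar:
  assumes "S \<subseteq> bounded_operators"
  shows "unital_Cstar_algebra (Cstar S)"
  unfolding Cstar_def
  using assms unital_Cstar_algebra_bounded_operators
  by (intro unital_Cstar_algebra_Inter) auto

lemma subset_Cstar: "S \<subseteq> Cstar S"
  by (auto simp: Cstar_def)

lemma unital_Cstar_algebraD:
  assumes "unital_Cstar_algebra A"
  shows "a \<in> A \<Longrightarrow> a \<in> bounded_operators"
    and "a \<in> A \<Longrightarrow> b \<in> A \<Longrightarrow> a + b \<in> A"
    and "a \<in> A \<Longrightarrow> c *\<^sub>C a \<in> A"
    and "id_blinfun \<in> A"
    and "a \<in> A \<Longrightarrow> b \<in> A \<Longrightarrow> a o\<^sub>L b \<in> A"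
    and "a \<in> A \<Longrightarrow> adj a \<in> A"
  using assms by (auto simp: unital_Cstar_algebra_def cvec.subspace_def)

section \<open>Two by two matrices and estimates for ucp maps\<close>

lemma UCPD:
  assumes "\<phi> \<in> UCP E F"
  shows "a \<in> E \<Longrightarrow> \<phi> a \<in> F"
    and "a \<in> E \<Longrightarrow> b \<in> E \<Longrightarrow> \<phi> (a + b) = \<phi> a + \<phi> b"
    and "a \<in> E \<Longrightarrow> \<phi> (c *\<^sub>C a) = c *\<^sub>C \<phi> a"
    and "\<phi> id_blinfun = id_blinfun"
    and "(\<And>i j. i < n \<Longrightarrow> j < n \<Longrightarrow> m i j \<in> E) \<Longrightarrow> positive_matrix n m \<Longrightarrow>
           positive_matrix n (\<lambda>i j. \<phi> (m i j))"
  using assms by (auto simp: UCP_def clinear_map_on_def completely_positive_def)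

text \<open>Every nonzero index is read as 1; \<open>positive_matrix 2\<close> only looks at the
  indices 0 and 1.\<close>

definition matrix2 :: "'a \<Rightarrow> 'a \<Rightarrow> 'a \<Rightarrow> 'a \<Rightarrow> nat \<Rightarrow> nat \<Rightarrow> 'a" where
  "matrix2 a b c d i j = (if i = 0 then if j = 0 then a else b else if j = 0 then c else d)"

lemma matrix2_image: "\<phi> (matrix2 a b c d i j) = matrix2 (\<phi> a) (\<phi> b) (\<phi> c) (\<phi> d) i j"
  by (simp add: matrix2_def)

lemma positive_matrix2_iff:
  "positive_matrix 2 (matrix2 a b c d) \<longleftrightarrow>
     (\<forall>x y. cinner (blinfun_apply a x) x + cinner (blinfun_apply b y) x
        + (cinner (blinfun_apply c x) y + cinner (blinfun_apply d y) y) \<in> \<real>\<^sub>\<ge>\<^sub>0)"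
  (is "?L \<longleftrightarrow> ?R")
proof
  assume L: ?L
  show ?R
  proof (intro allI)
    fix x y
    show "cinner (a x) x + cinner (b y) x + (cinner (c x) y + cinner (d y) y) \<in> \<real>\<^sub>\<ge>\<^sub>0"
      using L[unfolded positive_matrix_def, rule_format, of "\<lambda>i. if i = 0 then x else y"]
      by (simp add: numeral_2_eq_2 matrix2_def)
  qed
qed (simp add: positive_matrix_def numeral_2_eq_2 matrix2_def)

lemma UCP_positive_matrix2:
  assumes "\<phi> \<in> UCP E F" "a \<in> E" "b \<in> E" "c \<in> E" "d \<in> E" "positive_matrix 2 (matrix2 a b c d)"
  shows "positive_matrix 2 (matrix2 (\<phi> a) (\<phi> b) (\<phi> c) (\<phi> d))"
  using UCPD(5)[OF assms(1), of 2 "matrix2 a b c d"] assms(2-6)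
  by (simp add: matrix2_image) (simp add: matrix2_def)

text \<open>The quadratic form is real and so are its diagonal terms, hence the sum of the two
  off-diagonal terms is real. Replacing \<open>y\<close> by \<open>\<i> *\<^sub>C y\<close> gives
  the second real equation. Applied to images of matrices, this shows that ucp maps preserve
  adjoints.\<close>

lemma positive_matrix2_offdiagonal:
  assumes pos: "positive_matrix 2 (matrix2 a b c d)" and b: "b \<in> bounded_operators"
    and real: "\<And>x. cinner (blinfun_apply a x) x \<in> \<real>" "\<And>x. cinner (blinfun_apply d x) x \<in> \<real>"
  shows "cinner (blinfun_apply c x) y = cnj (cinner (blinfun_apply b y) x)"
proof -
  have *: "Im (cinner (b y) x + cinner (c x) y) = 0" for x y
  proof -
    have "Im (cinner (a x) x + cinner (b y) x + (cinner (c x) y + cinner (d y) y)) = 0"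
      using pos[unfolded positive_matrix2_iff, rule_format, of x y]
      by (simp_all add: complex_nonneg_Reals_iff)
    then show ?thesis
      using real(1)[of x] real(2)[of y] by (simp add: complex_is_Real_iff)
  qed
  show ?thesis
    using *[of y x] *[of "\<i> *\<^sub>C y" x]
    by (intro complex_eqI)
      (simp_all add: bounded_operatorsD b cinner_scaleC_left cinner_scaleC_right)
qed

text \<open>By Cauchy-Schwarz the form is at least
  \<open>norm a * (norm x - norm y)\<^sup>2\<close>. This encodes the operator norm as positivity of
  a matrix, which a ucp map preserves.\<close>

lemma positive_matrix2_norm:
  assumes a: "a \<in> bounded_operators"
  shows "positive_matrix 2 (matrix2 (norm a *\<^sub>R id_blinfun) a (adj a) (norm a *\<^sub>R id_blinfun))"
  unfolding positive_matrix2_iff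
proof (intro allI)
  fix x y
  have "- Re (cinner (a y) x) \<le> norm (a y) * norm x"
    using Cauchy_Schwarz_Re[of "a y" "- x"] by (simp add: cinner_minus_right)
  also have "\<dots> \<le> (norm a * norm y) * norm x"
    by (intro mult_right_mono norm_blinfun) simp
  finally have "- Re (cinner (a y) x) \<le> norm a * (norm x * norm y)"
    by (simp add: mult_ac)
  moreover have "0 \<le> norm a * (norm x - norm y)\<^sup>2" by simp
  ultimately have "0 \<le> norm a * (norm x)\<^sup>2 + norm a * (norm y)\<^sup>2 + 2 * Re (cinner (a y) x)"
    by (simp add: power2_diff algebra_simps)
  moreover have "cinner (a y) x + cinner x (a y) = complex_of_real (2 * Re (cinner (a y) x))"
    by (subst (2) cinner_commute) (simp add: complex_add_cnj)
  then have "cinner ((norm a *\<^sub>R id_blinfun) x) x + cinner (a y) x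
      + (cinner (adj a x) y + cinner ((norm a *\<^sub>R id_blinfun) y) y)
    = complex_of_real (norm a * (norm x)\<^sup>2 + norm a * (norm y)\<^sup>2 + 2 * Re (cinner (a y) x))"
    by (simp add: cinner_adj_left[OF a] blinfun.scaleR_left cinner_scaleR_left cinner_self
        algebra_simps)
  ultimately show "cinner ((norm a *\<^sub>R id_blinfun) x) x + cinner (a y) x
      + (cinner (adj a x) y + cinner ((norm a *\<^sub>R id_blinfun) y) y) \<in> \<real>\<^sub>\<ge>\<^sub>0"
    by (simp only: nonneg_Reals_of_real_iff)
qed

text \<open>Brings real multiples of the identity under the complex linearity of ucp maps.\<close>

lemma scaleR_blinfun_eq_scaleC:
  "r *\<^sub>R T = complex_of_real r *\<^sub>C (T :: 'a::real_normed_vector \<Rightarrow>\<^sub>L 'b::complex_hilbert)"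
  by (rule blinfun_eqI) (simp add: blinfun.scaleR_left scaleC_blinfun.rep_eq scaleR_scaleC)

text \<open>Contractivity of ucp maps: the matrix of \<open>positive_matrix2_norm\<close> stays
  positive under \<phi>, and its diagonal is fixed because \<phi> is unital. The form version
  confines each matrix coefficient to a disc that does not depend on \<phi>.\<close>

lemma UCP_cmod_cinner_le:
  assumes A: "unital_Cstar_algebra A" and \<phi>: "\<phi> \<in> UCP A bounded_operators" and a: "a \<in> A"
  shows "cmod (cinner (blinfun_apply (\<phi> a) x) y) \<le> norm a * (norm x * norm y)"
proof -
  note AD = unital_Cstar_algebraD[OF A]
  let ?I = "norm a *\<^sub>R id_blinfun"
  have \<phi>I: "\<phi> ?I = ?I"
    by (simp add: scaleR_blinfun_eq_scaleC UCPD(3,4)[OF \<phi>] AD)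
  have I: "?I \<in> A" by (simp add: scaleR_blinfun_eq_scaleC AD)
  have b: "\<phi> a \<in> bounded_operators"
    using UCPD(1)[OF \<phi> a] .
  have pos: "positive_matrix 2 (matrix2 ?I (\<phi> a) (\<phi> (adj a)) ?I)"
    using UCP_positive_matrix2[OF \<phi> I a AD(6)[OF a] I positive_matrix2_norm] AD(1) a
    by (simp add: \<phi>I)
  have adj: "cinner (\<phi> (adj a) x) y = cnj (cinner (\<phi> a y) x)" for x y
    by (rule positive_matrix2_offdiagonal[OF pos b])
      (simp_all add: blinfun.scaleR_left cinner_scaleR_left cinner_self)
  have ineq: "- (2 * Re (cinner (\<phi> a y) x)) \<le> norm a * ((norm x)\<^sup>2 + (norm y)\<^sup>2)" for x y
  proof -
    have "0 \<le> Re (cinner (?I x) x + cinner (\<phi> a y) x + (cinner (\<phi> (adj a) x) y + cinner (?I y) y))"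
      using pos[unfolded positive_matrix2_iff, rule_format, of x y]
      by (simp_all add: complex_nonneg_Reals_iff)
    then show ?thesis
      by (simp add: adj blinfun.scaleR_left cinner_scaleR_left norm_sq_cinner[symmetric]
          algebra_simps)
  qed
  \<comment> \<open>On unit vectors the sum of squares in \<open>ineq\<close> is 2 and cancels the
    factor 2. The vector \<open>- y\<close> reverses the sign, and the scalar \<open>u\<close> moved
    into \<open>x\<close> supplies the rotations. General vectors follow by homogeneity.\<close>
  have unit: "cmod (cinner (\<phi> a x) y) \<le> norm a" if "norm x = 1" "norm y = 1" for x y
  proof (rule cmod_le_of_Re_rotations_le)
    fix u :: complex assume "cmod u = 1"
    then show "Re (u * cinner (\<phi> a x) y) \<le> norm a"
      using ineq[of "u *\<^sub>C x" "- y"] that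
      by (simp add: bounded_operatorsD[OF b] cinner_scaleC_left cinner_minus_right norm_scaleC)
  qed simp
  show ?thesis
  proof (cases "x = 0 \<or> y = 0")
    case False
    have "cinner (\<phi> a x) y = of_real (norm x * norm y) * cinner (\<phi> a (sgn x)) (sgn y)"
      using False by (simp add: sgn_div_norm blinfun.scaleR_right cinner_scaleR_left
          cinner_scaleR_right field_simps)
    then have "cmod (cinner (\<phi> a x) y) = norm x * norm y * cmod (cinner (\<phi> a (sgn x)) (sgn y))"
      by (simp add: norm_mult)
    also have "\<dots> \<le> norm x * norm y * norm a"
      using unit[of "sgn x" "sgn y"] False by (intro mult_left_mono) (simp_all add: norm_sgn)
    finally show ?thesis by (simp add: mult_ac)
  qed auto
qed

text \<open>The matrix with entries 1, \<open>a\<close>, \<open>adj a\<close>,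
  \<open>adj a o\<^sub>L a\<close> is positive because its form is the squared norm of
  \<open>x + a y\<close>. Its image under \<phi> is positive too, and a suitable choice of vectors
  gives the Schwarz inequality.\<close>

lemma UCP_Schwarz:
  assumes A: "unital_Cstar_algebra A" and \<phi>: "\<phi> \<in> UCP A bounded_operators" and a: "a \<in> A"
  shows "(norm (blinfun_apply (\<phi> a) x))\<^sup>2 \<le> Re (cinner (blinfun_apply (\<phi> (adj a o\<^sub>L a)) x) x)"
proof -
  note AD = unital_Cstar_algebraD[OF A]
  have aB: "a \<in> bounded_operators" using AD(1)[OF a] .
  have aa: "adj a o\<^sub>L a \<in> A" using AD(5)[OF AD(6)[OF a] a] .
  have "positive_matrix 2 (matrix2 id_blinfun a (adj a) (adj a o\<^sub>L a))"
    unfolding positive_matrix2_iff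
  proof (intro allI)
    fix x y
    have "cinner (id_blinfun x) x + cinner (a y) x
        + (cinner (adj a x) y + cinner ((adj a o\<^sub>L a) y) y) = cinner (x + a y) (x + a y)"
      by (simp add: cinner_adj_left[OF aB] cinner_add_left cinner_add_right)
    then show "cinner (id_blinfun x) x + cinner (a y) x
        + (cinner (adj a x) y + cinner ((adj a o\<^sub>L a) y) y) \<in> \<real>\<^sub>\<ge>\<^sub>0"
      by (simp only: cinner_self nonneg_Reals_of_real_iff) simp
  qed
  from UCP_positive_matrix2[OF \<phi> AD(4) a AD(6)[OF a] aa this]
  have pos: "positive_matrix 2 (matrix2 id_blinfun (\<phi> a) (\<phi> (adj a)) (\<phi> (adj a o\<^sub>L a)))"
    by (simp add: UCPD(4)[OF \<phi>])
  \<comment> \<open>With second vector \<open>x\<close>, the image form is minimal at the first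
    vector \<open>- ?v\<close>, where its value is the difference of the two sides of the
    claim.\<close>
  let ?v = "\<phi> a x"
  have ge: "0 \<le> Re (cinner v v + cinner (\<phi> a w) v
      + (cinner (\<phi> (adj a) v) w + cinner (\<phi> (adj a o\<^sub>L a) w) w))"
    and im: "Im (cinner v v + cinner (\<phi> a w) v
      + (cinner (\<phi> (adj a) v) w + cinner (\<phi> (adj a o\<^sub>L a) w) w)) = 0" for v w
    using pos[unfolded positive_matrix2_iff, rule_format, of v w]
    by (simp_all add: complex_nonneg_Reals_iff)
  \<comment> \<open>The first vector 0 isolates the lower right corner, whose reality is needed to
    identify the off-diagonal entries as adjoints.\<close>
  have real: "cinner (\<phi> (adj a o\<^sub>L a) w) w \<in> \<real>" for w
    using im[of 0 w] by (simp add: complex_is_Real_iff)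
  have "cinner (\<phi> (adj a) (- ?v)) x = cnj (cinner (\<phi> a x) (- ?v))"
    using UCPD(1)[OF \<phi> a]
    by (intro positive_matrix2_offdiagonal[OF pos _ _ real]) (simp_all add: cinner_self)
  then show ?thesis
    using ge[of "- ?v" x]
    by (simp add: cinner_minus_left cinner_minus_right norm_sq_cinner)
qed

section \<open>Compactness of the set of ucp maps\<close>

text \<open>By Tychonoff the product of the \<open>K i\<close> is compact, so the image of
  \<open>F\<close> under \<Phi> has a cluster point \<open>f\<close>. A finer filter takes the place
  of a subsequence, since the index type \<open>'i\<close> is arbitrary.\<close>

lemma ex_subfilter_pointwise_tendsto:
  fixes \<Phi> :: "'n \<Rightarrow> 'i \<Rightarrow> 'b::topological_space"
  assumes F: "F \<noteq> bot" and K: "\<And>i. compact (K i)" "\<And>n i. \<Phi> n i \<in> K i"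
  shows "\<exists>G f. G \<noteq> bot \<and> G \<le> F \<and> (\<forall>i. ((\<lambda>n. \<Phi> n i) \<longlongrightarrow> f i) G)"
proof -
  have "compactin (product_topology (\<lambda>i. euclidean) UNIV) (PiE UNIV K)"
    using K(1) by (simp add: compactin_PiE)
  then have "compact (PiE UNIV K)"
    by (simp add: euclidean_product_topology)
  moreover have "eventually (\<lambda>f. f \<in> PiE UNIV K) (filtermap \<Phi> F)"
    using K(2) by (auto simp: eventually_filtermap intro!: always_eventually)
  moreover have "filtermap \<Phi> F \<noteq> bot"
    using F by (simp add: filtermap_bot_iff)
  ultimately obtain f where f: "inf (nhds f) (filtermap \<Phi> F) \<noteq> bot"
    unfolding compact_filter by blast
  \<comment> \<open>Pulling the neighbourhoods of \<open>f\<close> back along \<Phi> forces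
    convergence to \<open>f\<close>; the meet with \<open>F\<close> keeps the filter below
    \<open>F\<close>.\<close>
  define G where "G = inf (filtercomap \<Phi> (nhds f)) F"
  have "filterlim \<Phi> (nhds f) G"
    by (simp add: G_def filterlim_iff_le_filtercomap)
  then have "((\<lambda>n. \<Phi> n i) \<longlongrightarrow> f i) G" for i
    by (rule continuous_on_tendsto_compose[OF continuous_on_product_coordinates]) auto
  \<comment> \<open>If \<open>G\<close> were trivial, \<Phi> would eventually avoid some
    neighbourhood of \<open>f\<close> along \<open>F\<close>, and \<open>f\<close> would not be a
    cluster point.\<close>
  moreover have "G \<noteq> bot"
  proof
    assume "G = bot"
    then obtain P Q where PQ: "eventually P (nhds f)" "eventually Q F"
        "\<And>n. P (\<Phi> n) \<Longrightarrow> Q n \<Longrightarrow> False"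
      unfolding G_def trivial_limit_def eventually_inf eventually_filtercomap by blast
    then have "eventually (\<lambda>g. \<not> P g) (filtermap \<Phi> F)"
      unfolding eventually_filtermap by (blast intro: eventually_mono)
    with PQ(1) have "eventually (\<lambda>_. False) (inf (nhds f) (filtermap \<Phi> F))"
      unfolding eventually_inf by blast
    with f show False by (simp add: trivial_limit_def)
  qed
  ultimately show ?thesis
    by (intro exI[of _ G] exI[of _ f]) (simp add: G_def)
qed

text \<open>Riesz representation in the second argument defines the operator pointwise; uniqueness
  of the representing vector makes it linear, and the bound on the form makes it bounded.\<close>

lemma bounded_sesquilinear_form_operator:
  fixes B :: "'h::complex_hilbert \<Rightarrow> 'h \<Rightarrow> complex"
  assumes add_left: "\<And>x x' y. B (x + x') y = B x y + B x' y"
    and scale_left: "\<And>c x y. B (c *\<^sub>C x) y = c * B x y"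
    and add_right: "\<And>x y y'. B x (y + y') = B x y + B x y'"
    and scale_right: "\<And>c x y. B x (c *\<^sub>C y) = cnj c * B x y"
    and bound: "\<And>x y. cmod (B x y) \<le> C * (norm x * norm y)"
  shows "\<exists>T\<in>bounded_operators. \<forall>x y. cinner (blinfun_apply T x) y = B x y"
proof -
  \<comment> \<open>\<open>B x\<close> is conjugate linear, so its conjugate is what Riesz
    represents.\<close>
  have "\<exists>z. \<forall>y. cnj (B x y) = cinner y z" for x
  proof (rule Riesz_complex_hilbert)
    show "bounded_linear (\<lambda>y. cnj (B x y))"
      by (rule bounded_linear_intro[where K = "C * norm x"])
        (use bound[of x] in \<open>simp_all add: add_right scaleR_scaleC scale_right
            scaleC_complex_def mult_ac\<close>)
  qed (simp add: scale_right)
  then obtain g where g: "\<And>x y. cinner y (g x) = cnj (B x y)" by metis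
  have g': "cinner (g x) y = B x y" for x y
    by (subst cinner_commute) (simp add: g)
  have scale: "g (c *\<^sub>C x) = c *\<^sub>C g x" for c x
    by (rule cinner_eqI) (simp add: g scale_left cinner_scaleC_right)
  have bl: "bounded_linear g"
  proof (rule bounded_linear_intro[where K = C])
    show "g (x + y) = g x + g y" for x y
      by (rule cinner_eqI) (simp add: g add_left cinner_add_right)
    show "g (r *\<^sub>R x) = r *\<^sub>R g x" for r x
      by (simp add: scaleR_scaleC scale)
    show "norm (g x) \<le> norm x * C" for x
    proof (cases "g x = 0")
      \<comment> \<open>No sign of \<open>C\<close> is given, so nonnegativity of
        \<open>norm x * C\<close> is read off from the bound at \<open>(x, x)\<close>.\<close>
      case True
      have "0 \<le> cmod (B x x)" by simp
      also have "\<dots> \<le> norm x * (norm x * C)" using bound[of x x] by (simp add: mult_ac)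
      finally show ?thesis
        using True by (cases "x = 0") (auto simp: zero_le_mult_iff)
    next
      case False
      have "norm (g x) * norm (g x) = Re (B x (g x))"
        by (simp add: g'[symmetric] norm_sq_cinner[symmetric] power2_eq_square)
      also have "\<dots> \<le> C * (norm x * norm (g x))"
        using bound[of x "g x"] complex_Re_le_cmod[of "B x (g x)"] by linarith
      finally have "norm (g x) * norm (g x) \<le> norm (g x) * (norm x * C)"
        by (simp add: mult_ac)
      with False show ?thesis by (simp add: mult_le_cancel_left)
    qed
  qed
  show ?thesis
    by (rule bexI[of _ "Blinfun g"])
      (simp_all add: bounded_operators_def bounded_linear_Blinfun_apply[OF bl] g' scale)
qed

text \<open>The coefficients lie in compact discs, so they converge simultaneously along a finer
  filter. For each \<open>a\<close> the limit is a bounded sesquilinear form, hence an operator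
  \<open>\<psi> a\<close>, and each defining condition of a ucp map passes to limits of
  coefficients.\<close>

lemma UCP_ex_cluster_point:
  fixes \<phi> :: "'n \<Rightarrow> ('l::complex_hilbert \<Rightarrow>\<^sub>L 'l) \<Rightarrow> ('h::complex_hilbert \<Rightarrow>\<^sub>L 'h)"
  assumes A: "unital_Cstar_algebra A" and F: "F \<noteq> bot"
    and \<phi>: "\<And>n. \<phi> n \<in> UCP A bounded_operators"
  shows "\<exists>G \<psi>. G \<noteq> bot \<and> G \<le> F \<and> \<psi> \<in> UCP A bounded_operators \<and>
    (\<forall>a\<in>A. \<forall>x y. ((\<lambda>n. cinner (blinfun_apply (\<phi> n a) x) y)
        \<longlongrightarrow> cinner (blinfun_apply (\<psi> a) x) y) G)"
proof -
  note AD = unital_Cstar_algebraD[OF A]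
  \<comment> \<open>Outside \<open>A\<close> nothing bounds \<phi>, so the value 0 keeps every
    coordinate in its disc.\<close>
  define \<Phi> where "\<Phi> n = (\<lambda>(a, x, y). if a \<in> A then cinner (\<phi> n a x) y else 0)" for n
  define K where "K = (\<lambda>(a :: 'l \<Rightarrow>\<^sub>L 'l, x :: 'h, y :: 'h).
    cball (0::complex) (norm a * (norm x * norm y)))"
  have "compact (K i)" "\<Phi> n i \<in> K i" for n i
    using UCP_cmod_cinner_le[OF A \<phi>] by (auto simp: K_def \<Phi>_def split: prod.splits)
  then obtain G f where G: "G \<noteq> bot" "G \<le> F" and f: "\<And>i. ((\<lambda>n. \<Phi> n i) \<longlongrightarrow> f i) G"
    using ex_subfilter_pointwise_tendsto[OF F, of K \<Phi>] by blast
  define B where "B a x y = f (a, x, y)" for a x y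
  have B: "((\<lambda>n. cinner (\<phi> n a x) y) \<longlongrightarrow> B a x y) G" if "a \<in> A" for a x y
    using f[of "(a, x, y)"] that by (simp add: \<Phi>_def B_def)
  \<comment> \<open>Limits along the nontrivial filter \<open>G\<close> are unique, so identities
    between coefficients of the \<phi> n carry over to \<open>B\<close>.\<close>
  have BI: "B a x y = c" if "a \<in> A" "((\<lambda>n. cinner (\<phi> n a x) y) \<longlongrightarrow> c) G" for a x y c
    using tendsto_unique[OF G(1) B that(2)] that(1) by blast
  have bo: "\<phi> n a \<in> bounded_operators" if "a \<in> A" for n a
    using UCPD(1)[OF \<phi> that] .
  have "\<exists>T\<in>bounded_operators. \<forall>x y. cinner (blinfun_apply T x) y = B a x y" if a: "a \<in> A" for a
  proof (rule bounded_sesquilinear_form_operator)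
    show "B a (x + x') y = B a x y + B a x' y" for x x' y
      using tendsto_add[OF B[OF a, of x y] B[OF a, of x' y]]
      by (intro BI[OF a]) (simp add: blinfun.add_right cinner_add_left)
    show "B a x (y + y') = B a x y + B a x y'" for x y y'
      using tendsto_add[OF B[OF a, of x y] B[OF a, of x y']]
      by (intro BI[OF a]) (simp add: cinner_add_right)
    show "B a (c *\<^sub>C x) y = c * B a x y" for c x y
      using tendsto_mult_left[OF B[OF a, of x y], of c]
      by (intro BI[OF a]) (simp add: bounded_operatorsD[OF bo[OF a]] cinner_scaleC_left)
    show "B a x (c *\<^sub>C y) = cnj c * B a x y" for c x y
      using tendsto_mult_left[OF B[OF a, of x y], of "cnj c"]
      by (intro BI[OF a]) (simp add: cinner_scaleC_right)
    show "cmod (B a x y) \<le> norm a * (norm x * norm y)" for x y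
      using UCP_cmod_cinner_le[OF A \<phi> a]
      by (intro tendsto_upperbound[OF tendsto_norm[OF B[OF a]] _ G(1)] always_eventually) blast
  qed
  then obtain \<psi> where \<psi>: "\<And>a. a \<in> A \<Longrightarrow> \<psi> a \<in> bounded_operators"
      "\<And>a x y. a \<in> A \<Longrightarrow> cinner (\<psi> a x) y = B a x y"
    by metis
  have lim: "((\<lambda>n. cinner (\<phi> n a x) y) \<longlongrightarrow> cinner (\<psi> a x) y) G" if "a \<in> A" for a x y
    using B[OF that] \<psi>(2)[OF that] by simp
  have eqI: "\<psi> a = T" if "a \<in> A" "\<And>x y. ((\<lambda>n. cinner (\<phi> n a x) y) \<longlongrightarrow> cinner (blinfun_apply T x) y) G"
    for a T
  proof (rule blinfun_eqI, rule cinner_eqI)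
    fix x y
    have "cinner (\<psi> a x) y = cinner (T x) y"
      using tendsto_unique[OF G(1) lim that(2)] that(1) by blast
    then show "cinner y (\<psi> a x) = cinner y (T x)"
      by (metis cinner_commute)
  qed
  have "\<psi> \<in> UCP A bounded_operators"
    unfolding UCP_def clinear_map_on_def completely_positive_def
  proof (intro CollectI conjI ballI allI impI)
    show "\<psi> \<in> A \<rightarrow> bounded_operators" using \<psi>(1) by blast
    show "\<psi> id_blinfun = id_blinfun"
      by (rule eqI) (simp_all add: AD UCPD(4)[OF \<phi>])
    show "\<psi> (a + b) = \<psi> a + \<psi> b" if "a \<in> A" "b \<in> A" for a b
      using tendsto_add[OF lim[OF that(1)] lim[OF that(2)]]
      by (intro eqI) (simp_all add: AD that UCPD(2)[OF \<phi>] blinfun.add_left cinner_add_left)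
    show "\<psi> (c *\<^sub>C a) = c *\<^sub>C \<psi> a" if "a \<in> A" for c a
      using tendsto_mult_left[OF lim[OF that]]
      by (intro eqI) (simp_all add: AD that UCPD(3)[OF \<phi>] scaleC_blinfun.rep_eq
          cinner_scaleC_left)
    fix n m
    assume m: "(\<forall>i<n. \<forall>j<n. m i j \<in> A) \<and> positive_matrix n m"
    show "positive_matrix n (\<lambda>i j. \<psi> (m i j))"
      unfolding positive_matrix_def
    proof
      fix x :: "nat \<Rightarrow> 'h"
      let ?s = "\<lambda>\<phi>. \<Sum>i<n. \<Sum>j<n. cinner (blinfun_apply (\<phi> (m i j)) (x j)) (x i)"
      \<comment> \<open>For fixed vectors, positivity of a matrix concerns a finite sum of
        coefficients, and the nonnegative reals are closed in the complex plane.\<close>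
      have "((\<lambda>k. ?s (\<phi> k)) \<longlongrightarrow> ?s \<psi>) G"
        using m by (intro tendsto_sum lim) auto
      moreover have "?s (\<phi> k) \<in> \<real>\<^sub>\<ge>\<^sub>0" for k
        using UCPD(5)[OF \<phi>[of k], of n m] m by (simp add: positive_matrix_def)
      ultimately show "?s \<psi> \<in> \<real>\<^sub>\<ge>\<^sub>0"
        using Lim_in_closed_set[OF closed_nonneg_Reals_complex _ G(1)]
        by (metis (no_types, lifting) always_eventually)
    qed
  qed
  with G lim show ?thesis by blast
qed

section \<open>Weak and strong convergence and the unique extension property\<close>

lemma BW_converges_iff:
  "BW_converges E \<phi> \<psi> \<longleftrightarrow> (\<forall>e\<in>E. \<forall>x y. (\<lambda>n. cinner (blinfun_apply (\<phi> n e) x) y)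
     \<longlonglongrightarrow> cinner (blinfun_apply (\<psi> e) x) y)"
  by (simp add: BW_converges_def blinfun.diff_left cinner_diff_left LIM_zero_iff)

lemma unique_extension_imp_BW_converges:
  assumes S: "S \<subseteq> bounded_operators" and uep: "unique_extension_property S \<pi>"
    and \<phi>: "\<And>n. \<phi> n \<in> UCP (Cstar S) bounded_operators" and conv: "BW_converges S \<phi> \<pi>"
  shows "BW_converges (Cstar S) \<phi> \<pi>"
proof (rule ccontr)
  assume "\<not> ?thesis"
  then obtain a x y where a: "a \<in> Cstar S"
    and nlim: "\<not> (\<lambda>n. cinner (\<phi> n a x) y) \<longlonglongrightarrow> cinner (\<pi> a x) y"
    unfolding BW_converges_iff by blast
  then obtain U where U: "open U" "cinner (\<pi> a x) y \<in> U"
    and not_ev: "\<not> eventually (\<lambda>n. cinner (\<phi> n a x) y \<in> U) sequentially"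
    unfolding tendsto_def by blast
  \<comment> \<open>\<open>F\<close> plays the role of the bad subsequence: it lives on the indices
    whose coefficient lies outside \<open>U\<close>, and is nontrivial because the coefficients are
    not eventually in \<open>U\<close>.\<close>
  define F where "F = inf sequentially (principal {n. cinner (\<phi> n a x) y \<notin> U})"
  have "F \<noteq> bot"
    using not_ev by (simp add: F_def trivial_limit_def eventually_inf_principal)
  from UCP_ex_cluster_point[OF unital_Cstar_algebra_Cstar[OF S] this, of \<phi>] \<phi>
  obtain G \<psi> where G: "G \<noteq> bot" "G \<le> F" and \<psi>: "\<psi> \<in> UCP (Cstar S) bounded_operators"
    and lim: "\<And>a x y. a \<in> Cstar S \<Longrightarrow>
      ((\<lambda>n. cinner (\<phi> n a x) y) \<longlongrightarrow> cinner (\<psi> a x) y) G"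
    by blast
  have "G \<le> sequentially"
    using G(2) by (simp add: F_def)
  have "\<psi> s = \<pi> s" if s: "s \<in> S" for s
  proof (rule blinfun_eqI, rule cinner_eqI)
    fix v w
    have "((\<lambda>n. cinner (\<phi> n s v) w) \<longlongrightarrow> cinner (\<pi> s v) w) G"
      using conv s \<open>G \<le> sequentially\<close> unfolding BW_converges_iff by (blast intro: tendsto_mono)
    then have "cinner (\<psi> s v) w = cinner (\<pi> s v) w"
      using tendsto_unique[OF G(1) lim] s subset_Cstar by blast
    then show "cinner w (\<psi> s v) = cinner w (\<pi> s v)"
      by (metis cinner_commute)
  qed
  \<comment> \<open>The cluster point now takes the value \<open>\<pi> a\<close>, so along
    \<open>G\<close> the coefficient is eventually in \<open>U\<close>, against
    \<open>G \<le> F\<close>.\<close>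
  with uep \<psi> a have "\<psi> a = \<pi> a"
    by (simp add: unique_extension_property_def)
  with lim[OF a, of x y] U have "eventually (\<lambda>n. cinner (\<phi> n a x) y \<in> U) G"
    by (simp add: tendsto_def)
  moreover have "eventually (\<lambda>n. cinner (\<phi> n a x) y \<notin> U) G"
    by (rule filter_leD[OF G(2)]) (simp add: F_def eventually_inf_principal)
  ultimately have "eventually (\<lambda>_. False) G"
    by eventually_elim simp
  with G(1) show False
    by (simp add: trivial_limit_def)
qed

lemma BS_converges_imp_BW_converges:
  fixes \<psi> :: "('a::complex_hilbert \<Rightarrow>\<^sub>L 'a) \<Rightarrow> ('b::complex_hilbert \<Rightarrow>\<^sub>L 'b)"
  assumes "BS_converges E \<phi> \<psi>"
  shows "BW_converges E \<phi> \<psi>"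
  unfolding BW_converges_def
proof (intro ballI allI)
  fix e and x y :: 'b assume "e \<in> E"
  then have "(\<lambda>n. norm ((\<phi> n e - \<psi> e) x) * norm y) \<longlonglongrightarrow> 0"
    using assms by (intro tendsto_mult_left_zero) (simp add: BS_converges_def)
  then show "(\<lambda>n. cinner ((\<phi> n e - \<psi> e) x) y) \<longlonglongrightarrow> 0"
    by (rule Lim_null_comparison[rotated]) (simp add: Cauchy_Schwarz_cinner)
qed

text \<open>Expanding the squared norm of \<open>(\<phi> n a - \<pi> a) x\<close> and applying the
  Schwarz inequality to its first term bounds it by \<open>q n\<close>. Only coefficients of \<phi>
  n enter \<open>q n\<close>, so weak convergence suffices, and the limit is 0 because \<pi> is
  multiplicative and preserves adjoints.\<close>

lemma BW_converges_representation_imp_BS_converges: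
  assumes A: "unital_Cstar_algebra A" and \<pi>: "star_representation A \<pi>"
    and \<phi>: "\<And>n. \<phi> n \<in> UCP A bounded_operators" and conv: "BW_converges A \<phi> \<pi>"
  shows "BS_converges A \<phi> \<pi>"
  unfolding BS_converges_def
proof (intro ballI allI)
  fix a x assume a: "a \<in> A"
  note AD = unital_Cstar_algebraD[OF A]
  define q where
    "q n = Re (cinner (\<phi> n (adj a o\<^sub>L a) x) x) - 2 * Re (cinner (\<phi> n a x) (\<pi> a x))
       + (norm (\<pi> a x))\<^sup>2" for n
  have aa: "adj a o\<^sub>L a \<in> A" using AD(5)[OF AD(6)[OF a] a] .
  have "\<pi> a \<in> bounded_operators" "\<pi> (adj a o\<^sub>L a) = adj (\<pi> a) o\<^sub>L \<pi> a"
    using \<pi> a AD(6)[OF a] by (auto simp: star_representation_def)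
  then have "cinner (\<pi> (adj a o\<^sub>L a) x) x = cinner (\<pi> a x) (\<pi> a x)"
    by (simp add: cinner_adj_left)
  moreover have "q \<longlonglongrightarrow> Re (cinner (\<pi> (adj a o\<^sub>L a) x) x)
      - 2 * Re (cinner (\<pi> a x) (\<pi> a x)) + (norm (\<pi> a x))\<^sup>2"
    unfolding q_def using conv a aa
    by (intro tendsto_intros) (simp_all add: BW_converges_iff)
  ultimately have q0: "q \<longlonglongrightarrow> 0"
    by (simp add: norm_sq_cinner)
  have "(norm ((\<phi> n a - \<pi> a) x))\<^sup>2 \<le> q n" for n
    using norm_add_sq[of "\<phi> n a x" "- \<pi> a x"] UCP_Schwarz[OF A \<phi> a, of n x]
    by (simp add: q_def blinfun.diff_left cinner_minus_right)
  then have "(\<lambda>n. (norm ((\<phi> n a - \<pi> a) x))\<^sup>2) \<longlonglongrightarrow> 0"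
    by (intro Lim_null_comparison[OF _ q0]) simp
  then show "(\<lambda>n. norm ((\<phi> n a - \<pi> a) x)) \<longlonglongrightarrow> 0"
    using tendsto_real_sqrt by fastforce
qed

lemma BW_converges_const_imp_eq:
  assumes "BW_converges E (\<lambda>n. \<phi>) \<psi>" "e \<in> E"
  shows "\<phi> e = \<psi> e"
proof (rule blinfun_eqI, rule cinner_eqI)
  fix x y
  have "cinner (\<phi> e x) y = cinner (\<psi> e x) y"
    using assms by (simp add: BW_converges_iff LIMSEQ_const_iff)
  then show "cinner y (\<phi> e x) = cinner y (\<psi> e x)"
    by (metis cinner_commute)
qed

lemma BS_converges_const: "(\<And>e. e \<in> E \<Longrightarrow> \<phi> e = \<psi> e) \<Longrightarrow> BS_converges E (\<lambda>n. \<phi>) \<psi>"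
  by (simp add: BS_converges_def)

theorem proposition2p2:
  fixes S A :: "('l::complex_hilbert \<Rightarrow>\<^sub>L 'l) set"
    and \<pi> :: "('l \<Rightarrow>\<^sub>L 'l) \<Rightarrow> ('h::complex_hilbert \<Rightarrow>\<^sub>L 'h)"
  assumes "operator_system S"
    and "separable_space (top_of_set S)"
    and "A = Cstar S"
    and "star_representation A \<pi>"
    and "separable_space (euclidean :: 'h topology)"
  shows "(unique_extension_property S \<pi> \<longleftrightarrow>
            (\<forall>\<phi>. (\<forall>n. \<phi> n \<in> UCP A bounded_operators) \<and> BW_converges S \<phi> \<pi>
                 \<longrightarrow> BW_converges A \<phi> \<pi>))
       \<and> (unique_extension_property S \<pi> \<longleftrightarrow>
            (\<forall>\<phi>. (\<forall>n. \<phi> n \<in> UCP A bounded_operators) \<and> BW_converges S \<phi> \<pi>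
                 \<longrightarrow> (\<exists>k :: nat \<Rightarrow> nat. strict_mono k \<and> BW_converges A (\<phi> \<circ> k) \<pi>)))
       \<and> (unique_extension_property S \<pi> \<longleftrightarrow>
            (\<forall>\<phi>. (\<forall>n. \<phi> n \<in> UCP A bounded_operators) \<and> BS_converges S \<phi> \<pi>
                 \<longrightarrow> BS_converges A \<phi> \<pi>))
       \<and> (unique_extension_property S \<pi> \<longleftrightarrow>
            (\<forall>\<phi>. (\<forall>n. \<phi> n \<in> UCP A bounded_operators) \<and> BS_converges S \<phi> \<pi>
                 \<longrightarrow> (\<exists>k :: nat \<Rightarrow> nat. strict_mono k \<and> BS_converges A (\<phi> \<circ> k) \<pi>)))"
  (is "(?U \<longleftrightarrow> ?W) \<and> (?U \<longleftrightarrow> ?Wk) \<and> (?U \<longleftrightarrow> ?B) \<and> (?U \<longleftrightarrow> ?Bk)")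
proof -
  have S: "S \<subseteq> bounded_operators"
    using assms(1) by (simp add: operator_system_def)
  have A: "unital_Cstar_algebra A"
    using unital_Cstar_algebra_Cstar[OF S] assms(3) by simp
  have UW: "?U \<Longrightarrow> ?W"
    using unique_extension_imp_BW_converges[OF S] assms(3) by blast
  have UB: ?B if ?U
  proof (intro allI impI, elim conjE)
    \<comment> \<open>Strong convergence on \<open>S\<close> is weakened first, extended to
      \<open>A\<close> in the weak sense, and then upgraded on \<open>A\<close>.\<close>
    fix \<phi> assume \<phi>: "\<forall>n. \<phi> n \<in> UCP A bounded_operators" and "BS_converges S \<phi> \<pi>"
    with UW[OF that] have "BW_converges A \<phi> \<pi>"
      using BS_converges_imp_BW_converges by blast
    with \<phi> show "BS_converges A \<phi> \<pi>"
      using BW_converges_representation_imp_BS_converges[OF A assms(4)] by blast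
  qed
  have id: "strict_mono (id :: nat \<Rightarrow> nat) \<and> BW_converges A \<phi> \<pi> = BW_converges A (\<phi> \<circ> id) \<pi>
      \<and> BS_converges A \<phi> \<pi> = BS_converges A (\<phi> \<circ> id) \<pi>" for \<phi>
    by (simp add: strict_mono_def)
  have WWk: "?W \<Longrightarrow> ?Wk" and BBk: "?B \<Longrightarrow> ?Bk"
    using id by blast+
  \<comment> \<open>A ucp extension of the restriction of \<pi> is tested as a constant sequence.
    Assuming strong convergence on \<open>S\<close> and concluding only weak convergence on
    \<open>A\<close> lets this one criterion serve both topologies.\<close>
  have UI: ?U if "\<And>\<phi>. \<phi> \<in> UCP A bounded_operators \<Longrightarrow> BS_converges S (\<lambda>n. \<phi>) \<pi> \<Longrightarrow>
      BW_converges A (\<lambda>n. \<phi>) \<pi>"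
    unfolding unique_extension_property_def
    using BW_converges_const_imp_eq[OF that[OF _ BS_converges_const]] assms(3) by blast
  \<comment> \<open>Every subsequence of a constant sequence is that sequence itself.\<close>
  have WkU: ?U if ?Wk
  proof (rule UI)
    fix \<phi> assume "\<phi> \<in> UCP A bounded_operators" "BS_converges S (\<lambda>n. \<phi>) \<pi>"
    then show "BW_converges A (\<lambda>n. \<phi>) \<pi>"
      using that[rule_format, of "\<lambda>n. \<phi>"] BS_converges_imp_BW_converges by (auto simp: o_def)
  qed
  have BkU: ?U if ?Bk
  proof (rule UI)
    fix \<phi> assume "\<phi> \<in> UCP A bounded_operators" "BS_converges S (\<lambda>n. \<phi>) \<pi>"
    then show "BW_converges A (\<lambda>n. \<phi>) \<pi>"
      using that[rule_format, of "\<lambda>n. \<phi>"] BS_converges_imp_BW_converges by (auto simp: o_def)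
  qed
  show ?thesis
    using UW UB WWk BBk WkU BkU by argo
qed

end
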